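(* Let $s\geq 0$ be an integer, let $k=2^s$, and let $A_1,\dots,A_k$ be $s$-convex sets of real numbers with $|A_i|\leq N$ for all $1\leq i\leq k$. Then \[ T(A_1,\dots,A_k) \ll N^{2^{s+1}-1-s+\alpha_s}, \] where $\alpha_0=0$ and $\alpha_s=\sum_{j=1}^s j2^{-j}$, and the implied constant depends only on $s$.
   Context: For finite sets $A_1,\dots,A_k\subset\mathbb{R}$, $T(A_1,\dots,A_k)$ denotes the number of $2k$-tuples $(a_1,\dots,a_k,a_1',\dots,a_k')$ with $a_i,a_i'\in A_i$ and $a_1+\dots+a_k=a_1'+\dots+a_k'$. Higher convexity of sequences is defined recursively: a finite real sequence $(x_1,\dots,x_m)$ is $0$-convex if it is strictly monotone, and for $s\geq1$ it is $s$-convex if the sequence of neighbouring differences $(x_{i+1}-x_i)_{i=1}^{m-1}$ is $(s-1)$-convex. A finite set $A\subset\mathbb{R}$ is $s$-convex if its elements listed in increasing order $a_1<\dots<a_N$ form an $s$-convex sequence (so every finite set is $0$-convex, and $1$-convex means the gaps $a_{i+1}-a_i$ are strictly monotone). $X\ll Y$ means $X\leq CY$ for a constant $C$. *)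

theory Defs
  imports Complex_Main "HOL-Library.FuncSet"
begin

definition diffs :: "real list \<Rightarrow> real list" where
  "diffs xs = map (\<lambda>i. xs ! (Suc i) - xs ! i) [0..<length xs - 1]"

fun convex_seq :: "nat \<Rightarrow> real list \<Rightarrow> bool" where
  "convex_seq 0 xs = (sorted_wrt (<) xs \<or> sorted_wrt (>) xs)"
| "convex_seq (Suc s) xs = convex_seq s (diffs xs)"

definition convex_set :: "nat \<Rightarrow> real set \<Rightarrow> bool" where
  "convex_set s A = (finite A \<and> convex_seq s (sorted_list_of_set A))"

definition T :: "nat \<Rightarrow> (nat \<Rightarrow> real set) \<Rightarrow> nat" where
  "T k A = card {(a, b). a \<in> PiE {..<k} A \<and> b \<in> PiE {..<k} A \<and>
                         (\<Sum>i<k. a i) = (\<Sum>i<k. b i)}"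

definition alpha :: "nat \<Rightarrow> real" where
  "alpha s = (\<Sum>j=1..s. real j / 2 ^ j)"

end

theory Submission
  imports Defs "HOL-Library.Poly_Mapping" "HOL-Analysis.L2_Norm" "HOL-Analysis.Convex"
begin

text \<open>
  In the group algebra of the additive group of reals, \<open>T(A\<^sub>1, \<dots>, A\<^sub>k)\<close> is the squared \<open>\<ell>\<^sup>2\<close> norm of the
  product of the indicators of the \<open>A\<^sub>i\<close>. The bound is proved by induction on \<open>s\<close>, where the elements
  of the \<open>A\<^sub>i\<close> are first split into boundedly many monotone pieces. Cut each piece into blocks of
  \<open>L\<close> consecutive elements. The points of \<open>A\<^sub>1 \<times> \<dots> \<times> A\<^sub>k\<close> with a given sum form an antichain, so they
  meet only \<open>O((N/L)\<^bsup>k-1\<^esup>)\<close> of the \<open>(N/L)\<^sup>k\<close> boxes of blocks, and by Cauchy--Schwarz it suffices to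
  count the coincidences within the boxes. Such a coincidence is a vanishing sum of \<open>k\<close> differences
  \<open>x (i + d) - x i\<close> with \<open>d < L\<close> (up to sign), and for fixed \<open>d > 0\<close> these form \<open>(s-1)\<close>-convex
  sequences. By Cauchy--Schwarz again, the number of vanishing sums is controlled by \<open>T\<close> for \<open>k/2\<close>
  sequences, that is, by the induction hypothesis. If this is \<open>N\<^bsup>k-\<sigma>\<^esup>\<close> with \<open>\<sigma> = s - \<alpha>\<^bsub>s-1\<^esub>\<close>, then
  \<open>L = N\<^bsup>\<sigma>/k\<^esup>\<close> is the best choice. It gives the exponent \<open>2k - 1 - \<sigma> + \<sigma>/k\<close>, which is at most the
  claimed one because \<open>\<sigma> \<le> s\<close>. Coincidences with some \<open>d = 0\<close> are harmless since products of fewer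
  indicators obey the bound interpolated from \<open>k/2\<close> factors.
\<close>

section \<open>The group algebra of the reals\<close>

type_synonym galg = "real \<Rightarrow>\<^sub>0 real"

abbreviation coeff :: "galg \<Rightarrow> real \<Rightarrow> real" where
  "coeff \<equiv> Poly_Mapping.lookup"

abbreviation supp :: "galg \<Rightarrow> real set" where
  "supp \<equiv> Poly_Mapping.keys"

abbreviation delta :: "real \<Rightarrow> galg" where
  "delta x \<equiv> Poly_Mapping.single x 1"

text \<open>The coefficient of \<open>f * reflect g\<close> at 0 is the inner product of
  \<open>f\<close> and \<open>g\<close>.\<close>

definition reflect :: "galg \<Rightarrow> galg" where
  "reflect f = Poly_Mapping.map_key uminus f"

definition l2 :: "galg \<Rightarrow> real" where
  "l2 f = L2_set (coeff f) (supp f)"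

lemma galg_expand: "f = (\<Sum>a\<in>supp f. Poly_Mapping.single a (coeff f a))" for f :: galg
  by (rule poly_mapping_eqI)
     (auto simp: lookup_sum lookup_single when_def in_keys_iff)

lemma coeff_single_mult: "coeff (Poly_Mapping.single a c * g) x = c * coeff g (x - a)"
proof -
  have "Poly_Mapping.single a c * g = (\<Sum>b\<in>supp g. Poly_Mapping.single (a + b) (c * coeff g b))"
    by (subst galg_expand[of g]) (simp add: sum_distrib_left mult_single)
  moreover have "(a + b = x) = (b = x - a)" for b by auto
  ultimately show ?thesis
    by (simp add: lookup_sum lookup_single when_def in_keys_iff)
qed

lemma coeff_mult: "coeff (f * g) x = (\<Sum>a\<in>supp f. coeff f a * coeff g (x - a))"
proof -
  have "f * g = (\<Sum>a\<in>supp f. Poly_Mapping.single a (coeff f a) * g)"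
    by (subst galg_expand[of f]) (simp add: sum_distrib_right)
  then show ?thesis by (simp add: lookup_sum coeff_single_mult)
qed

lemma coeff_reflect [simp]: "coeff (reflect f) x = coeff f (- x)"
  by (simp add: reflect_def map_key.rep_eq)

lemma supp_reflect: "supp (reflect f) = uminus ` supp f"
  by (force simp: in_keys_iff image_iff)

lemma reflect_single: "reflect (Poly_Mapping.single a c) = Poly_Mapping.single (- a) c"
  by (rule poly_mapping_eqI) (auto simp: lookup_single when_def)

lemma reflect_one [simp]: "reflect 1 = 1"
  using reflect_single[of 0 1] by simp

lemma reflect_sum: "reflect (sum f A) = (\<Sum>i\<in>A. reflect (f i))"
  by (rule poly_mapping_eqI) (simp add: lookup_sum)

lemma reflect_mult: "reflect (f * g) = reflect f * reflect g"
proof (rule poly_mapping_eqI)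
  fix x
  show "coeff (reflect (f * g)) x = coeff (reflect f * reflect g) x"
    by (simp add: coeff_mult supp_reflect sum.reindex minus_diff_commute)
qed

lemma reflect_prod: "reflect (prod f A) = (\<Prod>i\<in>A. reflect (f i))"
  by (induction A rule: infinite_finite_induct) (simp_all add: reflect_mult)

lemma reflect_prod_list: "reflect (prod_list fs) = prod_list (map reflect fs)"
  by (induction fs) (simp_all add: reflect_mult)

section \<open>The norm and the Cauchy--Schwarz inequality\<close>

lemma l2_superset:
  assumes "finite S" "supp f \<subseteq> S"
  shows "l2 f = L2_set (coeff f) S"
  unfolding l2_def L2_set_def using assms
  by (intro arg_cong[where f = sqrt] sum.mono_neutral_left) (auto simp: in_keys_iff)

lemma l2_nonneg [simp]: "0 \<le> l2 f"
  by (simp add: l2_def)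

lemma l2_zero [simp]: "l2 0 = 0"
  by (simp add: l2_def)

lemma l2_one [simp]: "l2 1 = 1"
  by (simp add: l2_def)

lemma l2_triangle: "l2 (f + g) \<le> l2 f + l2 g"
proof -
  let ?S = "supp f \<union> supp g"
  have "l2 (f + g) = L2_set (\<lambda>x. coeff f x + coeff g x) ?S"
    using Poly_Mapping.keys_add[of f g]
    by (subst l2_superset[of ?S]) (auto simp: lookup_add intro: L2_set_cong)
  also have "\<dots> \<le> L2_set (coeff f) ?S + L2_set (coeff g) ?S"
    by (rule L2_set_triangle_ineq)
  also have "\<dots> = l2 f + l2 g"
    by (simp add: l2_superset[of ?S])
  finally show ?thesis .
qed

lemma l2_scale: "l2 (Poly_Mapping.single 0 c * f) = \<bar>c\<bar> * l2 f"
proof -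
  have "supp (Poly_Mapping.single 0 c * f) \<subseteq> supp f"
    by (auto simp: in_keys_iff coeff_single_mult)
  then have "l2 (Poly_Mapping.single 0 c * f) = L2_set (\<lambda>x. c * coeff f x) (supp f)"
    by (subst l2_superset[of "supp f"]) (auto simp: coeff_single_mult intro: L2_set_cong)
  then show ?thesis
    by (simp add: L2_set_def l2_def power_mult_distrib real_sqrt_mult flip: sum_distrib_left)
qed

lemma l2_square: "(l2 f)\<^sup>2 = coeff (f * reflect f) 0"
  by (simp add: l2_def L2_set_def coeff_mult sum_nonneg power2_eq_square)

lemma l2_square_superset:
  assumes "finite S" "supp f \<subseteq> S"
  shows "(l2 f)\<^sup>2 = (\<Sum>x\<in>S. (coeff f x)\<^sup>2)"
  by (simp add: l2_superset[OF assms] L2_set_def sum_nonneg)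

lemma l2_reflect [simp]: "l2 (reflect f) = l2 f"
  by (simp add: l2_def L2_set_def supp_reflect sum.reindex)

text \<open>Cauchy--Schwarz, since the left side is the inner product of \<open>f\<close> and
  \<open>reflect g\<close>.\<close>

lemma coeff_mult_0_le: "coeff (f * g) 0 \<le> l2 f * l2 g"
proof -
  let ?S = "supp f \<union> supp (reflect g)"
  have "coeff (f * g) 0 = (\<Sum>a\<in>?S. coeff f a * coeff (reflect g) a)"
    by (auto simp: coeff_mult in_keys_iff intro!: sum.mono_neutral_left)
  also have "\<dots> \<le> (\<Sum>a\<in>?S. \<bar>coeff f a\<bar> * \<bar>coeff (reflect g) a\<bar>)"
    by (intro sum_mono) (metis abs_ge_self abs_mult)
  also have "\<dots> \<le> L2_set (coeff f) ?S * L2_set (coeff (reflect g)) ?S"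
    by (rule L2_set_mult_ineq)
  also have "\<dots> = l2 f * l2 (reflect g)"
    by (simp only: l2_superset[of ?S, symmetric] finite_UnI finite_keys Un_upper1 Un_upper2)
  finally show ?thesis by simp
qed

text \<open>Nonnegativity is included so that domination survives multiplication.\<close>

definition dominated :: "galg \<Rightarrow> galg \<Rightarrow> bool" where
  "dominated f g \<longleftrightarrow> (\<forall>x. 0 \<le> coeff f x \<and> coeff f x \<le> coeff g x)"

lemma dominated_mult:
  assumes "dominated f f'" "dominated g g'"
  shows "dominated (f * g) (f' * g')"
proof -
  \<comment> \<open>Where \<open>f'\<close> vanishes, so does \<open>f\<close>; hence both products
    can be expanded over \<open>supp f'\<close>.\<close>
  have eq: "coeff (h * g) x = (\<Sum>a\<in>supp f'. coeff h a * coeff g (x - a))"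
    if "h = f \<or> h = f'" for h g x
  proof -
    have "supp h \<subseteq> supp f'" using that assms(1)
      by (auto simp: dominated_def in_keys_iff) (metis order.antisym)
    then show ?thesis
      by (auto simp: coeff_mult in_keys_iff intro!: sum.mono_neutral_left)
  qed
  show ?thesis
    using assms unfolding dominated_def
    by (auto simp: eq intro!: sum_nonneg sum_mono mult_nonneg_nonneg mult_mono intro: order_trans)
qed

lemma dominated_prod:
  assumes "\<And>i. i \<in> A \<Longrightarrow> dominated (f i) (g i)"
  shows "dominated (prod f A) (prod g A)"
  using assms
proof (induction A rule: infinite_finite_induct)
  case (insert x F)
  then show ?case by (simp add: dominated_mult)
qed (auto simp: dominated_def lookup_one when_def)

lemma supp_prod:
  assumes "finite A" "z \<in> supp (prod f A)"
  shows "\<exists>y. (\<forall>i\<in>A. y i \<in> supp (f i)) \<and> z = (\<Sum>i\<in>A. y i)"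
  using assms
proof (induction A arbitrary: z rule: finite_induct)
  case (insert i A)
  from insert.prems have "z \<in> supp (f i * prod f A)" using insert.hyps by simp
  then obtain a b where ab: "a \<in> supp (f i)" "b \<in> supp (prod f A)" "z = a + b"
    using keys_mult[of "f i" "prod f A"] by blast
  from insert.IH[OF ab(2)] obtain y where y: "\<forall>i\<in>A. y i \<in> supp (f i)" "b = (\<Sum>i\<in>A. y i)" by blast
  show ?case
    by (rule exI[of _ "y(i := a)"]) (use insert.hyps ab y in \<open>auto intro!: sum.cong\<close>)
qed auto

section \<open>Norms of products\<close>

text \<open>
  Discrete form of the monotonicity of \<open>L\<^sup>p\<close> norms, based on the fact that the square of the
  norm of a product of \<open>j\<close> factors is a coefficient of a product of \<open>2j\<close> factors. These are
  regrouped as \<open>2\<^sup>r + (2j - 2\<^sup>r)\<close> if there are enough of them. This replaces \<open>j\<close> by its double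
  modulo \<open>2\<^sup>r\<close>, so \<open>r\<close> repetitions suffice.
\<close>

lemma l2_prod_list_le_power:
  assumes F: "\<And>f. f \<in> F \<Longrightarrow> reflect f \<in> F" and K: "0 \<le> K"
    and top: "\<And>fs. set fs \<subseteq> F \<Longrightarrow> length fs = 2 ^ r \<Longrightarrow> l2 (prod_list fs) \<le> K ^ 2 ^ r"
    and fs: "set fs \<subseteq> F" "length fs \<le> 2 ^ r"
  shows "l2 (prod_list fs) \<le> K ^ length fs"
proof -
  define n where "n = (2::nat) ^ r"
  \<comment> \<open>The induction on \<open>m\<close> counts the doublings modulo \<open>n\<close>
    that are left: \<open>m = 0\<close> leaves only the lengths 0 and \<open>n\<close>, and
    \<open>m = r\<close> covers every length.\<close>
  have "l2 (prod_list fs) \<le> K ^ length fs"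
    if "n dvd 2 ^ m * length fs" "set fs \<subseteq> F" "length fs \<le> n" for m fs
    using that
  proof (induction m arbitrary: fs)
    case 0
    then have "length fs = 0 \<or> length fs = n" using dvd_imp_le[of n "length fs"] by (cases "length fs = 0") auto
    then show ?case using 0 top by (auto simp: n_def)
  next
    case (Suc m)
    have dvd: "n dvd 2 ^ m * (2 * length fs)"
      using Suc.prems(1) by (simp only: power_Suc2 mult.assoc)
    define gs where "gs = fs @ map reflect fs"
    have gs: "set gs \<subseteq> F" "length gs = 2 * length fs"
      using Suc.prems F by (auto simp: gs_def)
    have sq: "(l2 (prod_list fs))\<^sup>2 = coeff (prod_list gs) 0"
      by (simp add: l2_square gs_def reflect_prod_list)
    have "coeff (prod_list gs) 0 \<le> K ^ (2 * length fs)"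
    proof (cases "2 * length fs \<le> n")
      case True
      have "n dvd 2 ^ m * length gs" using dvd gs(2) by simp
      then have "l2 (prod_list gs) \<le> K ^ (2 * length fs)"
        using Suc.IH[of gs] gs True by simp
      then show ?thesis using coeff_mult_0_le[of "prod_list gs" 1] by simp
    next
      case False
      have "n dvd 2 ^ m * length (drop n gs)"
        using dvd_diff_nat[OF dvd, of "2 ^ m * n"] gs(2) by (simp add: diff_mult_distrib2)
      then have 1: "l2 (prod_list (drop n gs)) \<le> K ^ (2 * length fs - n)"
        using Suc.IH[of "drop n gs"] gs Suc.prems(3) order_trans[OF set_drop_subset gs(1)] by simp
      have 2: "l2 (prod_list (take n gs)) \<le> K ^ n"
        using top[of "take n gs"] gs False order_trans[OF set_take_subset gs(1)] by (simp add: n_def)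
      have "coeff (prod_list gs) 0 \<le> l2 (prod_list (take n gs)) * l2 (prod_list (drop n gs))"
        using coeff_mult_0_le[of "prod_list (take n gs)" "prod_list (drop n gs)"]
        by (simp flip: prod_list.append)
      also have "\<dots> \<le> K ^ n * K ^ (2 * length fs - n)"
        using 1 2 K by (intro mult_mono) auto
      also have "\<dots> = K ^ (2 * length fs)"
        using False by (simp flip: power_add)
      finally show ?thesis by (simp only: mult.commute)
    qed
    then have "(l2 (prod_list fs))\<^sup>2 \<le> (K ^ length fs)\<^sup>2"
      by (simp add: sq power_even_eq)
    then show ?case by (rule power2_le_imp_le) (simp add: K)
  qed
  from this[of r fs] show ?thesis using fs by (simp add: n_def)
qed

section \<open>Expansion of products of sums\<close>

lemma l2_mult_sum_list_le:
  assumes "\<And>g. g \<in> set G \<Longrightarrow> l2 (h * g * p) \<le> c * \<phi> g"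
  shows "l2 (h * sum_list G * p) \<le> c * sum_list (map \<phi> G)"
  using assms
proof (induction G)
  case (Cons g G)
  have "l2 (h * sum_list (g # G) * p) = l2 (h * g * p + h * sum_list G * p)"
    by (simp add: algebra_simps)
  also have "\<dots> \<le> l2 (h * g * p) + l2 (h * sum_list G * p)" by (rule l2_triangle)
  also have "\<dots> \<le> c * \<phi> g + c * sum_list (map \<phi> G)"
    using Cons by (intro add_mono) auto
  finally show ?case by (simp add: algebra_simps)
qed simp

text \<open>The product is expanded by multilinearity and bounded by the triangle inequality. The
  prefix \<open>h\<close> and the constant \<open>c\<close> absorb the summands already chosen,
  which the induction on \<open>Gs\<close> requires.\<close>

lemma l2_prod_sum_list_le:
  assumes "\<And>gs. list_all2 (\<lambda>g G. g \<in> set G) gs Gs \<Longrightarrow>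
             l2 (h * prod_list gs) \<le> c * prod_list (map \<phi> gs)"
  shows "l2 (h * prod_list (map sum_list Gs)) \<le>
    c * prod_list (map (\<lambda>G. sum_list (map \<phi> G)) Gs)"
  using assms
proof (induction Gs arbitrary: h c)
  case (Cons G Gs)
  have "l2 (h * g * prod_list (map sum_list Gs))
      \<le> (c * prod_list (map (\<lambda>G. sum_list (map \<phi> G)) Gs)) * \<phi> g" if g: "g \<in> set G" for g
  proof -
    have "l2 (h * g * prod_list gs) \<le> (c * \<phi> g) * prod_list (map \<phi> gs)"
      if "list_all2 (\<lambda>g G. g \<in> set G) gs Gs" for gs
      using Cons.prems[of "g # gs"] that g by (simp add: ac_simps)
    from Cons.IH[OF this] show ?thesis by (simp add: ac_simps)
  qed
  from l2_mult_sum_list_le[OF this] show ?case by (simp add: ac_simps)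
qed simp

text \<open>A multiple of the unit only scales the norm, so it can be pulled out. What remains is a
  shorter product of members of \<open>F\<close>, which is why \<open>bd\<close> is assumed for all
  lengths up to \<open>n\<close>.\<close>

lemma l2_prod_list_mixed_le:
  assumes bd: "\<And>fs. set fs \<subseteq> F \<Longrightarrow> length fs \<le> n \<Longrightarrow> l2 (prod_list fs) \<le> K ^ length fs"
    and c: "0 \<le> c" and K: "0 \<le> K"
    and gs: "set gs \<subseteq> insert (Poly_Mapping.single 0 c) F" "length gs \<le> n"
  shows "l2 (prod_list gs) \<le> (\<Prod>g\<leftarrow>gs. if g \<in> F then K else c)"
proof -
  \<comment> \<open>The norm is not submultiplicative, so the members of \<open>F\<close> are
    collected in \<open>fs\<close> and \<open>bd\<close> is applied once at the end.\<close>
  have "l2 (prod_list fs * prod_list gs) \<le> K ^ length fs * (\<Prod>g\<leftarrow>gs. if g \<in> F then K else c)"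
    if "set fs \<subseteq> F" "length fs + length gs \<le> n" for fs
    using gs(1) that
  proof (induction gs arbitrary: fs)
    case Nil
    then show ?case using bd by simp
  next
    case (Cons g gs)
    show ?case
    proof (cases "g \<in> F")
      case True
      then show ?thesis using Cons.IH[of "g # fs"] Cons.prems by (simp add: ac_simps)
    next
      case False
      then have g: "g = Poly_Mapping.single 0 c" using Cons.prems by auto
      have "l2 (prod_list fs * prod_list (g # gs)) = c * l2 (prod_list fs * prod_list gs)"
        using l2_scale[of c "prod_list fs * prod_list gs"] c by (simp add: g ac_simps)
      also have "\<dots> \<le> c * (K ^ length fs * (\<Prod>g\<leftarrow>gs. if g \<in> F then K else c))"
        using Cons.IH[of fs] Cons.prems c by (intro mult_left_mono) auto
      finally show ?thesis using False by (simp add: ac_simps)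
    qed
  qed
  from this[of "[]"] gs(2) show ?thesis by simp
qed

section \<open>Separated boxes\<close>

text \<open>
  If a box exceeds another one in every coordinate, then so do the sums of their points. Hence on
  each diagonal line of boxes at most one contains a representation of \<open>z\<close>.
\<close>

lemma card_separated_boxes_le:
  fixes f :: "nat \<Rightarrow> nat \<Rightarrow> galg"
  assumes sep: "\<And>i b b' y y'. i < k \<Longrightarrow> b < b' \<Longrightarrow> b' \<le> B \<Longrightarrow> y \<in> supp (f i b) \<Longrightarrow>
      y' \<in> supp (f i b') \<Longrightarrow> y < y'"
    and k: "0 < k"
  shows "card {Q \<in> PiE {..<k} (\<lambda>_. {..B}). z \<in> supp (\<Prod>i<k. f i (Q i))} \<le> (2 * B + 1) ^ (k - 1)"
proof -
  let ?S = "{Q \<in> PiE {..<k} (\<lambda>_. {..B}). z \<in> supp (\<Prod>i<k. f i (Q i))}"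
  \<comment> \<open>\<open>?h\<close> records the diagonal line of a box through its offsets from
    coordinate 0. Adding \<open>B\<close> first keeps the subtraction of naturals exact and puts the
    offsets in \<open>{0..2 * B}\<close>.\<close>
  let ?h = "\<lambda>Q. restrict (\<lambda>i. Q i + B - Q 0) {1..<k}"
  have less: False if Q: "Q \<in> ?S" and Q': "Q' \<in> ?S" and eq: "?h Q = ?h Q'" and lt: "Q 0 < Q' 0" for Q Q'
  proof -
    from Q obtain y where y: "\<forall>i<k. y i \<in> supp (f i (Q i))" "z = (\<Sum>i<k. y i)"
      using supp_prod[of "{..<k}" z "\<lambda>i. f i (Q i)"] by auto
    from Q' obtain y' where y': "\<forall>i<k. y' i \<in> supp (f i (Q' i))" "z = (\<Sum>i<k. y' i)"
      using supp_prod[of "{..<k}" z "\<lambda>i. f i (Q' i)"] by auto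
    have B: "Q i \<le> B" "Q' i \<le> B" if "i < k" for i
      using Q Q' that by (auto simp: PiE_iff)
    have "Q i < Q' i" if i: "i < k" for i
    proof (cases "i = 0")
      case False
      then have "Q i + B - Q 0 = Q' i + B - Q' 0" using fun_cong[OF eq, of i] i by simp
      then show ?thesis using lt B[OF k] B[OF i] by linarith
    qed (use lt in simp)
    then have "y i < y' i" if "i < k" for i
      using sep[of i "Q i" "Q' i" "y i" "y' i"] y y' B that by auto
    then have "(\<Sum>i<k. y i) < (\<Sum>i<k. y' i)"
      using k by (intro sum_strict_mono) auto
    then show False using y y' by simp
  qed
  have "inj_on ?h ?S"
  proof (rule inj_onI)
    fix Q Q' assume Q: "Q \<in> ?S" and Q': "Q' \<in> ?S" and eq: "?h Q = ?h Q'"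
    have 0: "Q 0 = Q' 0"
      using less[OF Q Q' eq] less[OF Q' Q eq[symmetric]] by (cases "Q 0" "Q' 0" rule: linorder_cases) auto
    show "Q = Q'"
    proof (rule PiE_ext[of _ "{..<k}" "\<lambda>_. {..B}"])
      fix i assume i: "i \<in> {..<k}"
      have "Q 0 \<le> B" using Q k by (auto simp: PiE_iff)
      then show "Q i = Q' i" using fun_cong[OF eq, of i] i 0 by (cases "i = 0") auto
    qed (use Q Q' in auto)
  qed
  moreover have "?h Q \<in> PiE {1..<k} (\<lambda>_. {..2 * B})" if "Q \<in> ?S" for Q
  proof (rule restrict_PiE_iff[THEN iffD2], rule ballI)
    fix i assume "i \<in> {1..<k}"
    then have "Q i \<le> B" using that by (auto simp: PiE_iff)
    then show "Q i + B - Q 0 \<in> {..2 * B}" by simp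
  qed
  then have "?h ` ?S \<subseteq> PiE {1..<k} (\<lambda>_. {..2 * B})" by (rule image_subsetI)
  ultimately have "card ?S \<le> card (PiE {1..<k} (\<lambda>_. {..2 * B}))"
    by (rule card_inj_on_le) (simp add: finite_PiE)
  then show ?thesis by (simp add: card_PiE)
qed

text \<open>For each \<open>z\<close> only the boxes that can represent \<open>z\<close> contribute,
  and Cauchy--Schwarz over them costs their number. The squared norms of the boxes are coefficients
  at 0, so their sum factors again into a product over \<open>i\<close>.\<close>

lemma l2_square_separated_boxes_le:
  fixes f :: "nat \<Rightarrow> nat \<Rightarrow> galg"
  assumes sep: "\<And>i b b' y y'. i < k \<Longrightarrow> b < b' \<Longrightarrow> b' \<le> B \<Longrightarrow> y \<in> supp (f i b) \<Longrightarrow>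
      y' \<in> supp (f i b') \<Longrightarrow> y < y'"
    and k: "0 < k"
  shows "(l2 (\<Prod>i<k. \<Sum>b\<le>B. f i b))\<^sup>2 \<le>
    (2 * real B + 1) ^ (k - 1) * coeff (\<Prod>i<k. \<Sum>b\<le>B. f i b * reflect (f i b)) 0"
proof -
  define QQ where "QQ = PiE {..<k} (\<lambda>_. {..B})"
  define g where "g Q = (\<Prod>i<k. f i (Q i))" for Q
  define M where "M = (2 * real B + 1) ^ (k - 1)"
  have fin: "finite QQ" by (simp add: QQ_def finite_PiE)
  have prod: "(\<Prod>i<k. \<Sum>b\<le>B. f i b) = (\<Sum>Q\<in>QQ. g Q)"
    unfolding g_def QQ_def by (rule prod_sum_PiE) auto
  define S where "S = (\<Union>Q\<in>QQ. supp (g Q))"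
  have S: "finite S" "supp (g Q) \<subseteq> S" if "Q \<in> QQ" for Q
    using fin that by (auto simp: S_def)
  have pt: "(\<Sum>Q\<in>QQ. coeff (g Q) z)\<^sup>2 \<le> M * (\<Sum>Q\<in>QQ. (coeff (g Q) z)\<^sup>2)" for z
  proof -
    let ?R = "{Q \<in> QQ. z \<in> supp (g Q)}"
    have "(\<Sum>Q\<in>QQ. coeff (g Q) z)\<^sup>2 = (\<Sum>Q\<in>?R. coeff (g Q) z)\<^sup>2"
      using fin by (intro arg_cong[where f = "\<lambda>x. x\<^sup>2"] sum.mono_neutral_right) (auto simp: in_keys_iff)
    also have "\<dots> \<le> (\<Sum>Q\<in>?R. (coeff (g Q) z)\<^sup>2) * real (card ?R)"
      by (rule sum_squared_le_sum_of_squares)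
    also have "\<dots> \<le> (\<Sum>Q\<in>QQ. (coeff (g Q) z)\<^sup>2) * M"
    proof (rule mult_mono)
      have "card ?R \<le> (2 * B + 1) ^ (k - 1)"
        unfolding QQ_def g_def by (rule card_separated_boxes_le[OF sep k])
      then have "real (card ?R) \<le> real ((2 * B + 1) ^ (k - 1))" by (rule of_nat_mono)
      then show "real (card ?R) \<le> M" by (simp add: M_def add.commute)
    qed (use fin in \<open>auto simp: M_def intro!: sum_mono2 sum_nonneg\<close>)
    finally show ?thesis by (simp only: mult.commute)
  qed
  have "supp (\<Sum>Q\<in>QQ. g Q) \<subseteq> S"
    using Poly_Mapping.keys_sum[of g QQ] by (simp add: S_def)
  then have "(l2 (\<Prod>i<k. \<Sum>b\<le>B. f i b))\<^sup>2 = (\<Sum>z\<in>S. (\<Sum>Q\<in>QQ. coeff (g Q) z)\<^sup>2)"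
    unfolding prod using fin
    by (subst l2_square_superset[of S]) (auto simp: lookup_sum S_def)
  also have "\<dots> \<le> (\<Sum>z\<in>S. M * (\<Sum>Q\<in>QQ. (coeff (g Q) z)\<^sup>2))"
    by (intro sum_mono pt)
  also have "\<dots> = M * (\<Sum>Q\<in>QQ. \<Sum>z\<in>S. (coeff (g Q) z)\<^sup>2)"
    by (simp add: sum_distrib_left sum.swap[of _ S])
  also have "(\<Sum>Q\<in>QQ. \<Sum>z\<in>S. (coeff (g Q) z)\<^sup>2) = (\<Sum>Q\<in>QQ. (l2 (g Q))\<^sup>2)"
    using S by (intro sum.cong l2_square_superset[symmetric]) auto
  also have "\<dots> = coeff (\<Sum>Q\<in>QQ. \<Prod>i<k. f i (Q i) * reflect (f i (Q i))) 0"
    by (simp add: l2_square lookup_sum g_def reflect_prod prod.distrib)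
  also have "(\<Sum>Q\<in>QQ. \<Prod>i<k. f i (Q i) * reflect (f i (Q i))) = (\<Prod>i<k. \<Sum>b\<le>B. f i b * reflect (f i b))"
    unfolding QQ_def by (rule prod_sum_PiE[symmetric]) auto
  finally show ?thesis by (simp add: M_def)
qed

section \<open>Convex sequences\<close>

text \<open>
  Sequences are used instead of sets because the differences \<open>x (i + d) - x i\<close> of an \<open>(s + 1)\<close>-convex
  sequence form an \<open>s\<close>-convex sequence which need be neither monotone nor injective.
\<close>

definition cvx :: "nat \<Rightarrow> (nat \<Rightarrow> real) \<Rightarrow> nat \<Rightarrow> bool" where
  "cvx s x m \<longleftrightarrow> convex_seq s (map x [0..<m])"

lemma cvx_0:
  "cvx 0 x m \<longleftrightarrow> (\<forall>i j. i < j \<longrightarrow> j < m \<longrightarrow> x i < x j) \<or> (\<forall>i j. i < j \<longrightarrow> j < m \<longrightarrow> x j < x i)"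
  by (simp add: cvx_def sorted_wrt_iff_nth_less)

lemma cvx_Suc: "cvx (Suc s) x m \<longleftrightarrow> cvx s (\<lambda>i. x (Suc i) - x i) (m - 1)"
proof -
  have "diffs (map x [0..<m]) = map (\<lambda>i. x (Suc i) - x i) [0..<m - 1]"
    by (rule nth_equalityI) (auto simp: diffs_def)
  then show ?thesis by (simp add: cvx_def)
qed

lemma cvx_empty [simp]: "cvx s x 0"
  by (induction s arbitrary: x) (simp_all add: cvx_0 cvx_Suc)

lemma cvx_uminus: "cvx s x m \<Longrightarrow> cvx s (\<lambda>i. - x i) m"
proof (induction s arbitrary: x m)
  case (Suc s)
  from Suc.IH[OF Suc.prems[unfolded cvx_Suc]] show ?case by (simp add: cvx_Suc)
qed (auto simp: cvx_0)

lemma cvx_segment: "cvx s x m \<Longrightarrow> u + w \<le> m \<Longrightarrow> cvx s (\<lambda>i. x (u + i)) w"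
proof (induction s arbitrary: x m w)
  case (Suc s)
  show ?case
  proof (cases w)
    case (Suc w')
    then show ?thesis
      using Suc.IH[OF Suc.prems(1)[unfolded cvx_Suc], of w'] Suc.prems(2) by (simp add: cvx_Suc)
  qed simp
qed (auto simp: cvx_0)

text \<open>Taking differences at distance \<open>d\<close> commutes with taking neighbouring
  differences, which reduces the claim to \<open>s = 0\<close>. There \<open>x (i + d) - x i\<close>
  is a sum of \<open>d\<close> consecutive gaps, each strictly monotone in \<open>i\<close>.\<close>

lemma cvx_difference: "cvx (Suc s) x m \<Longrightarrow> 0 < d \<Longrightarrow> cvx s (\<lambda>i. x (i + d) - x i) (m - d)"
proof (induction s arbitrary: x m)
  case 0
  have tele: "x (i + d) - x i = (\<Sum>t<d. x (Suc (i + t)) - x (i + t))" for i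
    using sum_lessThan_telescope[of "\<lambda>t. x (i + t)" d] by simp
  from 0(1) consider
    "\<forall>i j. i < j \<longrightarrow> j < m - 1 \<longrightarrow> x (Suc i) - x i < x (Suc j) - x j" |
    "\<forall>i j. i < j \<longrightarrow> j < m - 1 \<longrightarrow> x (Suc j) - x j < x (Suc i) - x i"
    unfolding cvx_Suc cvx_0 by blast
  then show ?case
  proof cases
    case 1
    have "x (i + d) - x i < x (j + d) - x j" if "i < j" "j < m - d" for i j
      unfolding tele using 0(2) that 1 by (intro sum_strict_mono) auto
    then show ?thesis by (simp add: cvx_0)
  next
    case 2
    have "x (j + d) - x j < x (i + d) - x i" if "i < j" "j < m - d" for i j
      unfolding tele using 0(2) that 2 by (intro sum_strict_mono) auto
    then show ?thesis by (simp add: cvx_0)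
  qed
next
  case (Suc s)
  from Suc.IH[OF Suc.prems(1)[unfolded cvx_Suc[of "Suc s"]] Suc.prems(2)]
  show ?case by (simp add: cvx_Suc[of s] algebra_simps diff_right_commute)
qed

section \<open>Splitting convex sequences into monotone pieces\<close>

text \<open>A pair \<open>(u, w)\<close> stands for the \<open>w\<close> consecutive indices starting at \<open>u\<close>.\<close>

definition is_split :: "(nat \<times> nat) list \<Rightarrow> nat \<Rightarrow> bool" where
  "is_split ps m \<longleftrightarrow> (\<forall>(u, w)\<in>set ps. u + w \<le> m) \<and>
     (\<forall>g :: nat \<Rightarrow> galg. (\<Sum>i<m. g i) = (\<Sum>(u, w)\<leftarrow>ps. \<Sum>i<w. g (u + i)))"

lemma increasingI:
  assumes "\<And>i. Suc i < w \<Longrightarrow> (x :: nat \<Rightarrow> real) i < x (Suc i)" "i < j" "j < w"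
  shows "x i < x j"
  using assms(2,3)
proof (induction j)
  case (Suc j)
  then have "x j < x (Suc j)" using assms(1) by simp
  then show ?case using Suc by (cases "i = j") auto
qed simp

text \<open>Strictly increasing gaps change sign at most once: the sequence falls up to a turning
  index \<open>a\<close> and rises after it, and \<open>a\<close> forms a piece of its own.\<close>

lemma strictly_convex_split:
  fixes x :: "nat \<Rightarrow> real"
  assumes "\<And>i j. i < j \<Longrightarrow> j < m - 1 \<Longrightarrow> x (Suc i) - x i < x (Suc j) - x j"
  shows "\<exists>ps. is_split ps m \<and> length ps \<le> 3 \<and> (\<forall>(u, w)\<in>set ps. cvx 0 (\<lambda>i. x (u + i)) w)"
proof -
  \<comment> \<open>The alternative \<open>m \<le> Suc i\<close> makes the minimum exist for a
    sequence that never stops falling.\<close>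
  define a where "a = (LEAST i. m \<le> Suc i \<or> x i \<le> x (Suc i))"
  have a: "m \<le> Suc a \<or> x a \<le> x (Suc a)"
    unfolding a_def by (rule LeastI[of _ m]) simp
  have am: "a \<le> m - 1" unfolding a_def by (rule Least_le, rule disjI1) linarith
  have dec: "x (Suc i) < x i" if "i < a" for i
    using not_less_Least[OF that[unfolded a_def]] by simp
  have inc: "x i < x (Suc i)" if "a < i" "Suc i < m" for i
  proof -
    have "i < m - 1" using that by linarith
    from assms[OF that(1) this] show ?thesis using a that by auto
  qed
  have 1: "cvx 0 x a"
    using increasingI[of a "\<lambda>i. - x i"] dec by (auto simp: cvx_0)
  have 2: "cvx 0 (\<lambda>i. x (Suc a + i)) (m - Suc a)"
    using increasingI[of "m - Suc a" "\<lambda>i. x (Suc a + i)"] inc by (auto simp: cvx_0)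
  show ?thesis
  proof (cases "m = 0")
    case True
    then show ?thesis by (intro exI[of _ "[]"]) (simp add: is_split_def)
  next
    case False
    have sum: "(\<Sum>i<m. g i) = (\<Sum>i<a. g i) + (g a + (\<Sum>i<m - Suc a. g (Suc a + i)))" for g :: "nat \<Rightarrow> galg"
    proof -
      have split: "(\<Sum>i<a + n. g i) = (\<Sum>i<a. g i) + (\<Sum>i<n. g (a + i))" for n
        by (induction n) (simp_all add: add.assoc)
      have "m = a + Suc (m - Suc a)" using False am by simp
      then have "(\<Sum>i<m. g i) = (\<Sum>i<a + Suc (m - Suc a). g i)" by simp
      also have "\<dots> = (\<Sum>i<a. g i) + (g a + (\<Sum>i<m - Suc a. g (Suc a + i)))"
        by (subst split, subst sum.lessThan_Suc_shift) simp
      finally show ?thesis .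
    qed
    show ?thesis
      by (intro exI[of _ "[(0, a), (a, 1), (Suc a, m - Suc a)]"])
         (use False am 1 2 sum in \<open>auto simp: is_split_def cvx_0\<close>)
  qed
qed

lemma cvx_1_split:
  assumes "cvx (Suc 0) x m"
  shows "\<exists>ps. is_split ps m \<and> length ps \<le> 3 \<and> (\<forall>(u, w)\<in>set ps. cvx 0 (\<lambda>i. x (u + i)) w)"
proof -
  from assms consider
    "\<forall>i j. i < j \<longrightarrow> j < m - 1 \<longrightarrow> x (Suc i) - x i < x (Suc j) - x j" |
    "\<forall>i j. i < j \<longrightarrow> j < m - 1 \<longrightarrow> x (Suc j) - x j < x (Suc i) - x i"
    unfolding cvx_Suc cvx_0 by blast
  then show ?thesis
  proof cases
    case 1
    then show ?thesis by (intro strictly_convex_split) auto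
  next
    case 2
    then obtain ps where ps: "is_split ps m" "length ps \<le> 3"
        "\<forall>(u, w)\<in>set ps. cvx 0 (\<lambda>i. - x (u + i)) w"
      using strictly_convex_split[of m "\<lambda>i. - x i"] by fastforce
    have "cvx 0 (\<lambda>i. x (u + i)) w" if "(u, w) \<in> set ps" for u w
      using ps(3) that cvx_uminus[of 0 "\<lambda>i. - x (u + i)" w] by auto
    then show ?thesis using ps(1,2) by blast
  qed
qed

lemma sum_list_map_concat:
  "(\<Sum>x\<leftarrow>concat xss. h x) = (\<Sum>xs\<leftarrow>xss. \<Sum>x\<leftarrow>xs. h x)" for h :: "'a \<Rightarrow> 'b :: comm_monoid_add"
  by (induction xss) simp_all

lemma is_split_concat:
  assumes "is_split ps m" "\<And>u w. (u, w) \<in> set ps \<Longrightarrow> is_split (q (u, w)) w"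
  shows "is_split (concat (map (\<lambda>(u, w). map (\<lambda>(a, l). (u + a, l)) (q (u, w))) ps)) m"
proof -
  have sum: "(\<Sum>i<w. g (u + i)) = (\<Sum>(a, l)\<leftarrow>q (u, w). \<Sum>i<l. g (u + a + i))"
    if "(u, w) \<in> set ps" for g :: "nat \<Rightarrow> galg" and u w
    using assms(2)[OF that] by (simp add: is_split_def add.assoc)
  have "(\<Sum>i<m. g i) = (\<Sum>(a, l)\<leftarrow>concat (map (\<lambda>(u, w). map (\<lambda>(a, l). (u + a, l)) (q (u, w))) ps). \<Sum>i<l. g (a + i))"
    for g :: "nat \<Rightarrow> galg"
  proof -
    have "(\<Sum>i<m. g i) = (\<Sum>(u, w)\<leftarrow>ps. \<Sum>i<w. g (u + i))"
      using assms(1) by (simp add: is_split_def)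
    also have "\<dots> = (\<Sum>(u, w)\<leftarrow>ps. \<Sum>(a, l)\<leftarrow>q (u, w). \<Sum>i<l. g (u + a + i))"
      using sum by (intro arg_cong[where f = sum_list] map_cong) auto
    finally show ?thesis
      by (simp add: sum_list_map_concat o_def case_prod_unfold)
  qed
  moreover have "u + a + l \<le> m" if "(u, w) \<in> set ps" "(a, l) \<in> set (q (u, w))" for u w a l
    using assms(1) assms(2)[OF that(1)] that by (fastforce simp: is_split_def)
  ultimately show ?thesis by (fastforce simp: is_split_def)
qed

text \<open>By induction the gaps fall into at most \<open>c\<close> monotone pieces. Over each of
  them \<open>x\<close> is 1-convex and splits into at most three monotone pieces. One further piece
  holds the last index, since \<open>m\<close> points have only \<open>m - 1\<close> gaps.\<close>

lemma cvx_split: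
  "\<exists>c. \<forall>x m. cvx s x m \<longrightarrow>
     (\<exists>ps. is_split ps m \<and> length ps \<le> c \<and> (\<forall>(u, w)\<in>set ps. cvx 0 (\<lambda>i. x (u + i)) w))"
proof (induction s)
  case 0
  show ?case
  proof (intro exI[of _ 1] allI impI)
    fix x m assume "cvx 0 x m"
    then show "\<exists>ps. is_split ps m \<and> length ps \<le> 1 \<and> (\<forall>(u, w)\<in>set ps. cvx 0 (\<lambda>i. x (u + i)) w)"
      by (intro exI[of _ "[(0, m)]"]) (simp add: is_split_def)
  qed
next
  case (Suc s)
  then obtain c where c: "\<And>x m. cvx s x m \<Longrightarrow> \<exists>ps. is_split ps m \<and> length ps \<le> c \<and>
      (\<forall>(u, w)\<in>set ps. cvx 0 (\<lambda>i. x (u + i)) w)" by blast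
  show ?case
  proof (intro exI[of _ "3 * c + 1"] allI impI)
    fix x m assume x: "cvx (Suc s) x m"
    from c[OF x[unfolded cvx_Suc]] obtain ps where ps: "is_split ps (m - 1)" "length ps \<le> c"
      "\<forall>(u, w)\<in>set ps. cvx 0 (\<lambda>i. x (Suc (u + i)) - x (u + i)) w" by blast
    have "\<exists>qs. is_split qs (snd p) \<and> length qs \<le> 3 \<and>
        (\<forall>(a, l)\<in>set qs. cvx 0 (\<lambda>i. x (fst p + (a + i))) l)" if "p \<in> set ps" for p
    proof -
      obtain u w where p: "p = (u, w)" by fastforce
      \<comment> \<open>The piece is used as a range of \<open>w\<close> points, which involve only
        the first \<open>w - 1\<close> of its \<open>w\<close> gaps.\<close>
      have "cvx 0 (\<lambda>i. x (u + Suc i) - x (u + i)) (w - 1)"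
        using ps(3) that cvx_segment[of 0 "\<lambda>i. x (Suc (u + i)) - x (u + i)" w 0 "w - 1"]
        by (auto simp: p)
      then show ?thesis using cvx_1_split[of "\<lambda>i. x (u + i)" w] by (simp add: cvx_Suc p)
    qed
    then obtain q where q: "\<And>p. p \<in> set ps \<Longrightarrow> is_split (q p) (snd p) \<and> length (q p) \<le> 3 \<and>
        (\<forall>(a, l)\<in>set (q p). cvx 0 (\<lambda>i. x (fst p + (a + i))) l)" by metis
    define rs where "rs = concat (map (\<lambda>(u, w). map (\<lambda>(a, l). (u + a, l)) (q (u, w))) ps)"
    have rs: "is_split rs (m - 1)"
      unfolding rs_def using ps(1) q by (intro is_split_concat) force+
    have cv: "\<forall>(u, w)\<in>set rs. cvx 0 (\<lambda>i. x (u + i)) w"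
      using q by (fastforce simp: rs_def add.assoc)
    have "length rs = (\<Sum>p\<leftarrow>ps. length (q p))"
      by (simp add: rs_def length_concat o_def case_prod_unfold)
    also have "\<dots> \<le> (\<Sum>p\<leftarrow>ps. 3)"
      using q by (intro sum_list_mono) auto
    finally have len: "length rs \<le> 3 * c" using ps(2) by (simp add: sum_list_triv)
    show "\<exists>ps. is_split ps m \<and> length ps \<le> 3 * c + 1 \<and> (\<forall>(u, w)\<in>set ps. cvx 0 (\<lambda>i. x (u + i)) w)"
    proof (cases m)
      case 0
      then show ?thesis using rs cv len by (intro exI[of _ rs]) auto
    next
      case (Suc m')
      then show ?thesis using rs cv len
        by (intro exI[of _ "rs @ [(m', 1)]"]) (fastforce simp: is_split_def cvx_0)
    qed
  qed
qed

section \<open>The induction step\<close>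

definition pts :: "(nat \<Rightarrow> real) \<Rightarrow> nat \<Rightarrow> galg" where
  "pts x m = (\<Sum>i<m. delta (x i))"

definition cvx_pts :: "nat \<Rightarrow> nat \<Rightarrow> galg set" where
  "cvx_pts s N = {pts x m |x m. cvx s x m \<and> m \<le> N}"

definition mono_cvx_pts :: "nat \<Rightarrow> nat \<Rightarrow> galg set" where
  "mono_cvx_pts s N = {pts x m |x m. cvx s x m \<and> cvx 0 x m \<and> m \<le> N}"

lemma reflect_pts: "reflect (pts x m) = pts (\<lambda>i. - x i) m"
  by (simp add: pts_def reflect_sum reflect_single)

lemma reflect_cvx_pts: "f \<in> cvx_pts s N \<Longrightarrow> reflect f \<in> cvx_pts s N"
  unfolding cvx_pts_def using cvx_uminus reflect_pts by fastforce

lemma cvx_pts_split: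
  "\<exists>c. \<forall>N. \<forall>f\<in>cvx_pts s N. \<exists>G. f = sum_list G \<and> length G \<le> c \<and> set G \<subseteq> mono_cvx_pts s N"
proof -
  obtain c where c: "\<And>x m. cvx s x m \<Longrightarrow>
     \<exists>ps. is_split ps m \<and> length ps \<le> c \<and> (\<forall>(u, w)\<in>set ps. cvx 0 (\<lambda>i. x (u + i)) w)"
    using cvx_split[of s] by blast
  have "\<exists>G. f = sum_list G \<and> length G \<le> c \<and> set G \<subseteq> mono_cvx_pts s N" if f: "f \<in> cvx_pts s N" for f N
  proof -
    from f obtain x m where x: "f = pts x m" "cvx s x m" "m \<le> N" by (auto simp: cvx_pts_def)
    from c[OF x(2)] obtain ps where ps: "is_split ps m" "length ps \<le> c"
      "\<forall>(u, w)\<in>set ps. cvx 0 (\<lambda>i. x (u + i)) w" by blast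
    have "pts (\<lambda>i. x (u + i)) w \<in> mono_cvx_pts s N" if "(u, w) \<in> set ps" for u w
    proof -
      have "u + w \<le> m" using ps(1) that by (auto simp: is_split_def)
      then show ?thesis using cvx_segment[OF x(2)] ps(3) that x(3)
        by (fastforce simp: mono_cvx_pts_def)
    qed
    moreover have "f = (\<Sum>(u, w)\<leftarrow>ps. pts (\<lambda>i. x (u + i)) w)"
      using ps(1) x(1) by (simp add: is_split_def pts_def)
    ultimately show ?thesis using ps(2)
      by (intro exI[of _ "map (\<lambda>(u, w). pts (\<lambda>i. x (u + i)) w) ps"]) auto
  qed
  then show ?thesis by blast
qed

text \<open>Substitution \<open>d = i - j\<close>. For \<open>g i j = delta (x i - x j)\<close> the
  inner sums become the difference sequences of \<open>cvx_difference\<close>.\<close>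

lemma sum_below_diagonal:
  fixes g :: "nat \<Rightarrow> nat \<Rightarrow> 'a :: comm_monoid_add"
  shows "(\<Sum>i<m. \<Sum>j\<in>{j. j < i \<and> i < j + L}. g i j) = (\<Sum>d\<in>{1..<L}. \<Sum>i<m - d. g (i + d) i)"
proof -
  have "(\<Sum>i<m. \<Sum>j\<in>{j. j < i \<and> i < j + L}. g i j) =
      (\<Sum>(i, j)\<in>Sigma {..<m} (\<lambda>i. {j. j < i \<and> i < j + L}). g i j)"
    by (rule sum.Sigma) auto
  also have "\<dots> = (\<Sum>(d, i)\<in>Sigma {1..<L} (\<lambda>d. {..<m - d}). g (i + d) i)"
    by (rule sum.reindex_bij_witness[where i = "\<lambda>(d, i). (i + d, i)" and j = "\<lambda>(i, j). (i - j, j)"]) auto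
  also have "\<dots> = (\<Sum>d\<in>{1..<L}. \<Sum>i<m - d. g (i + d) i)"
    by (rule sum.Sigma[symmetric]) auto
  finally show ?thesis .
qed

lemma sum_near_diagonal:
  fixes g :: "nat \<Rightarrow> nat \<Rightarrow> 'a :: comm_monoid_add"
  assumes L: "0 < L"
  shows "(\<Sum>i<m. \<Sum>j\<in>{j. j < m \<and> i < j + L \<and> j < i + L}. g i j) =
    (\<Sum>i<m. g i i) + ((\<Sum>d\<in>{1..<L}. \<Sum>i<m - d. g (i + d) i) + (\<Sum>d\<in>{1..<L}. \<Sum>i<m - d. g i (i + d)))"
proof -
  let ?U = "\<lambda>i. {j. i < j \<and> j < m \<and> j < i + L}" and ?D = "\<lambda>i. {j. j < i \<and> i < j + L}"
  have split: "(\<Sum>j\<in>{j. j < m \<and> i < j + L \<and> j < i + L}. g i j) =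
      g i i + ((\<Sum>j\<in>?D i. g i j) + (\<Sum>j\<in>?U i. g i j))" if "i < m" for i
  proof -
    have "{j. j < m \<and> i < j + L \<and> j < i + L} = insert i (?D i \<union> ?U i)"
      using that L by auto
    moreover have "finite (?D i)" "finite (?U i)" "?D i \<inter> ?U i = {}" "i \<notin> ?D i \<union> ?U i" by auto
    ultimately show ?thesis by (simp add: sum.union_disjoint)
  qed
  have "(\<Sum>i<m. \<Sum>j\<in>?U i. g i j) = (\<Sum>j<m. \<Sum>i\<in>?D j. g i j)"
  proof -
    have "(\<Sum>i<m. \<Sum>j\<in>?U i. g i j) = (\<Sum>(i, j)\<in>Sigma {..<m} ?U. g i j)"
      by (rule sum.Sigma) auto
    also have "\<dots> = (\<Sum>(j, i)\<in>Sigma {..<m} ?D. g i j)"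
      by (rule sum.reindex_bij_witness[where i = prod.swap and j = prod.swap]) auto
    also have "\<dots> = (\<Sum>j<m. \<Sum>i\<in>?D j. g i j)"
      by (rule sum.Sigma[symmetric]) auto
    finally show ?thesis .
  qed
  then have U: "(\<Sum>i<m. \<Sum>j\<in>?U i. g i j) = (\<Sum>d\<in>{1..<L}. \<Sum>i<m - d. g i (i + d))"
    using sum_below_diagonal[of "\<lambda>j i. g i j" L m] by simp
  have "(\<Sum>i<m. \<Sum>j\<in>{j. j < m \<and> i < j + L \<and> j < i + L}. g i j) =
      (\<Sum>i<m. g i i + ((\<Sum>j\<in>?D i. g i j) + (\<Sum>j\<in>?U i. g i j)))"
    using split by (intro sum.cong) auto
  then show ?thesis by (simp add: sum.distrib U sum_below_diagonal)
qed

text \<open>Indices are cut at multiples of \<open>L\<close>. For a decreasing sequence the blocks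
  are numbered backwards, so that larger block numbers always mean larger values.\<close>

lemma cvx_0_blocks:
  assumes x: "cvx 0 x m" and m: "m \<le> N" and L: "0 < L"
  shows "\<exists>blk. (\<forall>i<m. blk i \<le> N div L) \<and> (\<forall>i<m. \<forall>j<m. blk i < blk j \<longrightarrow> x i < x j) \<and>
    (\<forall>i<m. \<forall>j<m. blk i = blk j \<longrightarrow> i < j + L)"
proof -
  have le: "i div L \<le> N div L" if "i < m" for i
    using that m by (intro div_le_mono) simp
  have near: "i < j + L" if "i div L = j div L" for i j
  proof -
    have "i < i div L * L + L" using L by (metis add.commute div_mult_mod_eq mod_less_divisor nat_add_left_cancel_less)
    also have "\<dots> \<le> j + L" by (simp add: that)
    finally show ?thesis .
  qed
  have mono: "i < j" if "i div L < j div L" for i j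
    using that by (meson div_le_mono leD leI)
  from x consider "\<forall>i j. i < j \<longrightarrow> j < m \<longrightarrow> x i < x j" | "\<forall>i j. i < j \<longrightarrow> j < m \<longrightarrow> x j < x i"
    unfolding cvx_0 by blast
  then show ?thesis
  proof cases
    case 1
    then show ?thesis using le near mono by (intro exI[of _ "\<lambda>i. i div L"]) blast
  next
    case 2
    have "i < j + L" if "i < m" "j < m" "N div L - i div L = N div L - j div L" for i j
      using near[of i j] le[OF that(1)] le[OF that(2)] that(3) by linarith
    moreover have "x i < x j" if "i < m" "j < m" "N div L - i div L < N div L - j div L" for i j
    proof -
      have "j div L < i div L" using that(3) by linarith
      then show ?thesis using 2 mono that(1) by blast
    qed
    ultimately show ?thesis by (intro exI[of _ "\<lambda>i. N div L - i div L"]) auto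
  qed
qed

text \<open>
  The convex sequences in \<open>G\<close> come from the pairs of distinct indices in a common block, ordered by
  the difference of the indices. The pairs of equal indices give the multiple of the unit.
\<close>

definition block_decomp :: "nat \<Rightarrow> nat \<Rightarrow> nat \<Rightarrow> galg \<Rightarrow> (nat \<Rightarrow> galg) \<Rightarrow> galg list \<Rightarrow> bool" where
  "block_decomp s N L f h G \<longleftrightarrow> f = (\<Sum>b\<le>N div L. h b) \<and>
    (\<forall>b b' y y'. b < b' \<longrightarrow> b' \<le> N div L \<longrightarrow> y \<in> supp (h b) \<longrightarrow> y' \<in> supp (h b') \<longrightarrow> y < y') \<and>
    set G \<subseteq> cvx_pts s N \<and> length G \<le> 2 * L \<and>
    dominated (\<Sum>b\<le>N div L. h b * reflect (h b)) (sum_list (Poly_Mapping.single 0 (real N) # G))"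

text \<open>\<open>h b * reflect (h b)\<close> lists the differences within block \<open>b\<close>.
  Pairs in a block have index distance below \<open>L\<close>; admitting all pairs that close only
  increases coefficients, and those regroup by distance into difference sequences and their
  negatives.\<close>

lemma mono_cvx_pts_block_decomp:
  assumes f: "f \<in> mono_cvx_pts (Suc s) N" and L: "0 < L"
  shows "\<exists>h G. block_decomp s N L f h G"
proof -
  from f obtain x m where x: "f = pts x m" "cvx (Suc s) x m" "cvx 0 x m" "m \<le> N"
    by (auto simp: mono_cvx_pts_def)
  from cvx_0_blocks[OF x(3,4) L] obtain blk where
    blk: "\<And>i. i < m \<Longrightarrow> blk i \<le> N div L"
    and sep: "\<And>i j. i < m \<Longrightarrow> j < m \<Longrightarrow> blk i < blk j \<Longrightarrow> x i < x j"
    and near: "\<And>i j. i < m \<Longrightarrow> j < m \<Longrightarrow> blk i = blk j \<Longrightarrow> i < j + L" by blast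
  define I where "I b = {i. i < m \<and> blk i = b}" for b
  have finI [simp]: "finite (I b)" for b by (simp add: I_def)
  define h where "h b = (\<Sum>i\<in>I b. delta (x i))" for b
  have group: "(\<Sum>b\<le>N div L. \<Sum>i\<in>I b. g b i) = (\<Sum>i<m. g (blk i) i)" for g :: "nat \<Rightarrow> nat \<Rightarrow> galg"
  proof -
    have "(\<Sum>b\<le>N div L. \<Sum>i\<in>I b. g b i) = (\<Sum>b\<le>N div L. \<Sum>i\<in>{i\<in>{..<m}. blk i = b}. g (blk i) i)"
      by (intro sum.cong) (auto simp: I_def)
    also have "\<dots> = (\<Sum>i<m. g (blk i) i)"
      using blk by (intro sum.group) auto
    finally show ?thesis .
  qed
  have supp: "\<exists>i<m. blk i = b \<and> y = x i" if "y \<in> supp (h b)" for y b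
    using that keys_sum[of "\<lambda>i. delta (x i)" "I b"] by (auto simp: h_def I_def)
  define G1 where "G1 = map (\<lambda>d. pts (\<lambda>i. x (i + d) - x i) (m - d)) [1..<L]"
  define G where "G = G1 @ map reflect G1"
  have G1: "set G1 \<subseteq> cvx_pts s N"
  proof
    fix g assume "g \<in> set G1"
    then obtain d where "d \<in> {1..<L}" and g: "g = pts (\<lambda>i. x (i + d) - x i) (m - d)"
      unfolding G1_def set_map set_upt by blast
    then have d: "0 < d" by simp
    have "m - d \<le> N" using x(4) by linarith
    with cvx_difference[OF x(2) d] g show "g \<in> cvx_pts s N"
      unfolding cvx_pts_def by blast
  qed
  have len: "length G \<le> 2 * L" by (simp add: G_def G1_def)
  have sumG1: "sum_list G1 = (\<Sum>d\<in>{1..<L}. \<Sum>i<m - d. delta (x (i + d) - x i))"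
    by (simp add: G1_def pts_def sum_list_distinct_conv_sum_set)
  have sumG2: "sum_list (map reflect G1) = (\<Sum>d\<in>{1..<L}. \<Sum>i<m - d. delta (x i - x (i + d)))"
    by (simp add: G1_def pts_def o_def reflect_sum reflect_single sum_list_distinct_conv_sum_set)
  have "(\<Sum>b\<le>N div L. h b * reflect (h b)) = (\<Sum>b\<le>N div L. \<Sum>i\<in>I b. \<Sum>j\<in>I b. delta (x i - x j))"
    by (simp add: h_def reflect_sum reflect_single sum_product mult_single)
  also have "\<dots> = (\<Sum>i<m. \<Sum>j\<in>I (blk i). delta (x i - x j))"
    by (rule group)
  finally have eq: "(\<Sum>b\<le>N div L. h b * reflect (h b)) = (\<Sum>i<m. \<Sum>j\<in>I (blk i). delta (x i - x j))" .
  have "dominated (\<Sum>i<m. \<Sum>j\<in>I (blk i). delta (x i - x j))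
      (sum_list (Poly_Mapping.single 0 (real N) # G))"
    unfolding dominated_def
  proof (intro allI conjI)
    fix z
    let ?c = "\<lambda>g. coeff g z"
    have pos: "0 \<le> ?c (delta y)" for y by (simp add: lookup_single when_def)
    show "0 \<le> ?c (\<Sum>i<m. \<Sum>j\<in>I (blk i). delta (x i - x j))"
      by (auto simp: lookup_sum intro!: sum_nonneg pos)
    have "?c (\<Sum>i<m. \<Sum>j\<in>I (blk i). delta (x i - x j)) \<le>
        ?c (\<Sum>i<m. \<Sum>j\<in>{j. j < m \<and> i < j + L \<and> j < i + L}. delta (x i - x j))"
      using near unfolding lookup_sum by (intro sum_mono sum_mono2 pos) (auto simp: I_def)
    also have "\<dots> = ?c ((\<Sum>i<m. delta 0) + sum_list G)"
      by (subst sum_near_diagonal[OF L]) (simp add: G_def sumG1 sumG2)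
    also have "\<dots> \<le> ?c (sum_list (Poly_Mapping.single 0 (real N) # G))"
      using x(4) by (simp add: lookup_add lookup_of_nat when_def)
    finally show "?c (\<Sum>i<m. \<Sum>j\<in>I (blk i). delta (x i - x j)) \<le>
        ?c (sum_list (Poly_Mapping.single 0 (real N) # G))" .
  qed
  moreover have "f = (\<Sum>b\<le>N div L. h b)"
    using group[of "\<lambda>b i. delta (x i)"] by (simp add: h_def x(1) pts_def)
  moreover have "y < y'" if "b < b'" "y \<in> supp (h b)" "y' \<in> supp (h b')" for b b' y y'
    using supp[OF that(2)] supp[OF that(3)] that(1) sep by blast
  moreover have "set G \<subseteq> cvx_pts s N"
    using G1 reflect_cvx_pts by (auto simp: G_def)
  ultimately have "block_decomp s N L f h G"
    unfolding block_decomp_def eq using len by blast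
  then show ?thesis by blast
qed

text \<open>Separated boxes reduce the norm to a coefficient of a product of
  \<open>2 ^ Suc r\<close> factors. Cauchy--Schwarz splits it into two halves of
  \<open>2 ^ r\<close> factors, each expanded into products that \<open>top\<close> and its
  interpolation to fewer factors control.\<close>

lemma energy_step:
  assumes top: "\<And>fs. set fs \<subseteq> cvx_pts r N \<Longrightarrow> length fs = 2 ^ r \<Longrightarrow> l2 (prod_list fs) \<le> K ^ 2 ^ r"
    and K: "0 \<le> K" and L: "0 < L"
    and fs: "set fs \<subseteq> mono_cvx_pts (Suc r) N" "length fs = 2 ^ Suc r"
  shows "(l2 (prod_list fs))\<^sup>2 \<le> (2 * real (N div L) + 1) ^ (2 ^ Suc r - 1) *
    (real N + (2 * real L + 1) * K) ^ 2 ^ Suc r"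
proof -
  define B where "B = N div L"
  define n where "n = (2::nat) ^ r"
  define k where "k = (2::nat) ^ Suc r"
  \<comment> \<open>At most \<open>2 * L\<close> sequences contribute \<open>K\<close> each and the
    unit contributes \<open>real N\<close>; the extra \<open>K\<close> covers the case that the
    multiple of the unit lies in \<open>cvx_pts r N\<close> itself, where \<open>?\<phi>\<close>
    gives \<open>K\<close>.\<close>
  define E where "E = real N + (2 * real L + 1) * K"
  have k: "0 < k" "k = n + n" by (auto simp: k_def n_def)
  have E: "0 \<le> E" using K by (simp add: E_def)
  have "\<exists>h G. block_decomp r N L (fs ! i) h G" if "i < k" for i
    using mono_cvx_pts_block_decomp[OF _ L] fs that by (metis k_def nth_mem subsetD)
  then obtain h G where bd: "\<And>i. i < k \<Longrightarrow> block_decomp r N L (fs ! i) (h i) (G i)"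
    by metis
  have h: "fs ! i = (\<Sum>b\<le>B. h i b)"
    and sep: "b < b' \<Longrightarrow> b' \<le> B \<Longrightarrow> y \<in> supp (h i b) \<Longrightarrow> y' \<in> supp (h i b') \<Longrightarrow> y < y'"
    and G: "set (G i) \<subseteq> cvx_pts r N" "length (G i) \<le> 2 * L"
    and dom: "dominated (\<Sum>b\<le>B. h i b * reflect (h i b)) (sum_list (Poly_Mapping.single 0 (real N) # G i))"
    if "i < k" for i b b' y y'
    using bd[OF that] unfolding block_decomp_def B_def by blast+
  define H where "H i = Poly_Mapping.single 0 (real N) # G i" for i
  let ?\<phi> = "\<lambda>g. if g \<in> cvx_pts r N then K else real N"
  have half: "l2 (prod_list (map sum_list (map H js))) \<le> E ^ n"
    if js: "length js = n" "\<And>i. i \<in> set js \<Longrightarrow> i < k" for js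
  proof -
    have bd: "l2 (prod_list gs) \<le> K ^ length gs" if "set gs \<subseteq> cvx_pts r N" "length gs \<le> n" for gs
      by (rule l2_prod_list_le_power[where F = "cvx_pts r N" and r = r])
         (use reflect_cvx_pts K top that in \<open>auto simp: n_def\<close>)
    have "l2 (1 * prod_list (map sum_list (map H js))) \<le>
        1 * (\<Prod>G\<leftarrow>map H js. \<Sum>g\<leftarrow>G. ?\<phi> g)"
    proof (rule l2_prod_sum_list_le)
      fix gs assume gs: "list_all2 (\<lambda>g G. g \<in> set G) gs (map H js)"
      have "set gs \<subseteq> insert (Poly_Mapping.single 0 (real N)) (cvx_pts r N)"
      proof
        fix g assume "g \<in> set gs"
        then obtain j where "j < length gs" "g = gs ! j" by (metis in_set_conv_nth)
        then have "j < length js" "g \<in> set (H (js ! j))"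
          using list_all2_nthD[OF gs, of j] list_all2_lengthD[OF gs] by auto
        then show "g \<in> insert (Poly_Mapping.single 0 (real N)) (cvx_pts r N)"
          using G(1)[of "js ! j"] js(2)[of "js ! j"] by (auto simp: H_def)
      qed
      moreover have "length gs \<le> n" using list_all2_lengthD[OF gs] js(1) by simp
      ultimately show "l2 (1 * prod_list gs) \<le> 1 * (\<Prod>g\<leftarrow>gs. ?\<phi> g)"
        unfolding mult_1_left by (intro l2_prod_list_mixed_le[OF bd _ K]) auto
    qed
    also have "(\<Prod>G\<leftarrow>map H js. \<Sum>g\<leftarrow>G. ?\<phi> g) = (\<Prod>i\<leftarrow>js. \<Sum>g\<leftarrow>H i. ?\<phi> g)" by (simp add: o_def)
    also have "\<dots> \<le> E ^ length js"
      using js(2)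
    proof (induction js)
      case (Cons i ks)
      have "(\<Sum>g\<leftarrow>G i. ?\<phi> g) = (\<Sum>g\<leftarrow>G i. K)"
        using G(1)[of i] Cons.prems by (intro arg_cong[where f = sum_list] map_cong) auto
      also have "\<dots> \<le> 2 * real L * K"
        using G(2)[of i] Cons.prems K by (auto simp: sum_list_triv intro!: mult_right_mono)
      finally have "(\<Sum>g\<leftarrow>H i. ?\<phi> g) \<le> E"
        using K by (simp add: H_def E_def algebra_simps)
      moreover have "0 \<le> (\<Prod>i\<leftarrow>ks. \<Sum>g\<leftarrow>H i. ?\<phi> g)"
        using K by (intro prod_list_nonneg) (auto intro!: sum_list_nonneg)
      ultimately show ?case using Cons E by (simp add: mult_mono)
    qed simp
    finally show ?thesis using js(1) by simp
  qed
  have prod: "(\<Prod>i\<in>set js. sum_list (H i)) = prod_list (map sum_list (map H js))" if "distinct js" for js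
    using that by (simp add: prod.distinct_set_conv_list o_def)
  have "prod_list fs = (\<Prod>i<k. \<Sum>b\<le>B. h i b)"
    using fs(2) h by (simp add: prod.list_conv_set_nth atLeast0LessThan k_def)
  then have "(l2 (prod_list fs))\<^sup>2 \<le>
      (2 * real B + 1) ^ (k - 1) * coeff (\<Prod>i<k. \<Sum>b\<le>B. h i b * reflect (h i b)) 0"
    using l2_square_separated_boxes_le[OF sep k(1)] by simp
  also have "\<dots> \<le> (2 * real B + 1) ^ (k - 1) * E ^ k"
  proof (rule mult_left_mono)
    have "coeff (\<Prod>i<k. \<Sum>b\<le>B. h i b * reflect (h i b)) 0 \<le> coeff (\<Prod>i<k. sum_list (H i)) 0"
      using dominated_prod[of "{..<k}" "\<lambda>i. \<Sum>b\<le>B. h i b * reflect (h i b)" "\<lambda>i. sum_list (H i)"] dom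
      by (simp add: dominated_def H_def)
    also have "(\<Prod>i<k. sum_list (H i)) = prod_list (map sum_list (map H [0..<n])) *
        prod_list (map sum_list (map H [n..<k]))"
      by (subst (1 2) prod[symmetric])
         (auto simp: k lessThan_atLeast0 prod.atLeastLessThan_concat)
    also have "coeff \<dots> 0 \<le> E ^ n * E ^ n"
      using coeff_mult_0_le half[of "[0..<n]"] half[of "[n..<k]"] E k
      by (intro order_trans[OF coeff_mult_0_le] mult_mono) auto
    finally show "coeff (\<Prod>i<k. \<Sum>b\<le>B. h i b * reflect (h i b)) 0 \<le> E ^ k"
      by (simp add: k power_add)
  qed simp
  finally show ?thesis by (simp only: B_def k_def E_def)
qed

section \<open>Exponents and the choice of the block length\<close>

lemma alpha_Suc: "alpha (Suc s) = alpha s + real (Suc s) / 2 ^ Suc s"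
  by (simp add: alpha_def)

lemma alpha_bounds: "0 \<le> alpha s" "alpha s \<le> real s"
proof -
  show "0 \<le> alpha s" unfolding alpha_def by (intro sum_nonneg) simp
  have "real j / 2 ^ j \<le> 1" for j
    using of_nat_less_two_power[of j, where ?'a = real] by (simp add: divide_le_eq)
  then have "alpha s \<le> (\<Sum>j=1..s. 1)" unfolding alpha_def by (intro sum_mono)
  then show "alpha s \<le> real s" by simp
qed

text \<open>The length \<open>L\<close>, about \<open>u\<close>, balances the two sources of
  coincidences: with \<open>u * v = N\<close> and \<open>K = C * v\<close>, the term
  \<open>L * K\<close> from the difference sequences has the order of the term \<open>N\<close> from
  equal indices, while only about \<open>v\<close> blocks remain.\<close>

lemma block_length_optimisation:
  fixes \<sigma> C :: real
  assumes N: "1 \<le> N" and k: "0 < k" and \<sigma>: "0 \<le> \<sigma>" "\<sigma> \<le> real k" and C: "1 \<le> C"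
    and K: "K = C * real N powr (1 - \<sigma> / k)" and L: "L = nat \<lceil>real N powr (\<sigma> / k)\<rceil>"
  shows "(2 * real (N div L) + 1) ^ (k - 1) * (real N + (2 * real L + 1) * K) ^ k \<le>
    3 ^ (k - 1) * (6 * C) ^ k * real N powr (2 * real k - 1 - \<sigma> + \<sigma> / k)"
proof -
  define u where "u = real N powr (\<sigma> / k)"
  define v where "v = real N powr (1 - \<sigma> / k)"
  have uv: "u * v = real N" using N by (simp add: u_def v_def flip: powr_add)
  have u: "1 \<le> u" using N \<sigma> by (auto simp: u_def intro!: ge_one_powr_ge_zero)
  have v: "1 \<le> v" using N \<sigma> k by (auto simp: v_def intro!: ge_one_powr_ge_zero)
  have L1: "u \<le> real L" "real L \<le> u + 1" using u by (simp_all add: L u_def[symmetric])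
  have "real (N div L) \<le> real N / real L" by (rule of_nat_div_le_of_nat)
  also have "\<dots> \<le> real N / u" using L1 u by (intro divide_left_mono) auto
  also have "\<dots> = v" using uv u by (simp add: field_simps)
  finally have 1: "2 * real (N div L) + 1 \<le> 3 * v" using v by linarith
  \<comment> \<open>Since \<open>1 \<le> u\<close>,
    \<open>2 * L + 1 \<le> 2 * u + 3 \<le> 5 * u\<close>.\<close>
  have "(2 * real L + 1) * K \<le> (5 * u) * (C * v)"
    unfolding K v_def[symmetric] using L1 u v C by (intro mult_right_mono) auto
  also have "\<dots> = 5 * C * real N" by (simp add: uv[symmetric])
  finally have "real N + (2 * real L + 1) * K \<le> real N + 5 * C * real N" by simp
  also have "\<dots> \<le> 6 * C * real N" using mult_right_mono[OF C, of "real N"] by simp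
  finally have 2: "real N + (2 * real L + 1) * K \<le> 6 * C * real N" .
  have K0: "0 \<le> K" using C by (simp add: K)
  have "(2 * real (N div L) + 1) ^ (k - 1) * (real N + (2 * real L + 1) * K) ^ k \<le>
      (3 * v) ^ (k - 1) * (6 * C * real N) ^ k"
    using 1 2 K0 v by (intro mult_mono power_mono) auto
  also have "\<dots> = 3 ^ (k - 1) * (6 * C) ^ k * (v ^ (k - 1) * real N ^ k)"
    by (simp add: power_mult_distrib)
  also have "v ^ (k - 1) * real N ^ k = real N powr ((1 - \<sigma> / k) * real (k - 1) + real k)"
    using N by (simp add: v_def powr_powr powr_add flip: powr_realpow)
  also have "(1 - \<sigma> / k) * real (k - 1) + real k = 2 * real k - 1 - \<sigma> + \<sigma> / k"
    using k by (simp add: of_nat_diff field_simps)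
  finally show ?thesis .
qed

section \<open>The induction on \<open>s\<close>\<close>

lemma l2_pts_injective:
  assumes "cvx 0 x m"
  shows "(l2 (pts x m))\<^sup>2 = real m"
proof -
  have "x i - x j = 0 \<longleftrightarrow> i = j" if "i < m" "j < m" for i j
    using assms that unfolding cvx_0 by (cases i j rule: linorder_cases) force+
  then have "(\<Sum>i<m. \<Sum>j<m. if x i - x j = 0 then 1 else 0) = (\<Sum>i<m. \<Sum>j<m. if i = j then 1 else (0::real))"
    by (intro sum.cong) auto
  then show ?thesis
    by (simp add: l2_square pts_def reflect_sum reflect_single sum_product mult_single lookup_sum lookup_single when_def)
qed

text \<open>Stated for sequences so that the induction can pass to differences, whose values may
  repeat. The bound \<open>1 \<le> C\<close> is carried along so that \<open>C\<close> may be
  replaced by \<open>C ^ k\<close>.\<close>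

lemma l2_prod_cvx_pts_le:
  "\<exists>C\<ge>1. \<forall>N\<ge>1. \<forall>fs. set fs \<subseteq> cvx_pts s N \<longrightarrow> length fs = 2 ^ s \<longrightarrow>
     (l2 (prod_list fs))\<^sup>2 \<le> C * real N powr (2 ^ (s + 1) - 1 - real s + alpha s)"
proof (induction s)
  case 0
  have "(l2 (prod_list fs))\<^sup>2 \<le> real N" if "set fs \<subseteq> cvx_pts 0 N" "length fs = 1" for N fs
  proof -
    from that obtain x m where "fs = [pts x m]" "cvx 0 x m" "m \<le> N"
      by (auto simp: cvx_pts_def length_Suc_conv)
    then show ?thesis by (simp add: l2_pts_injective)
  qed
  then show ?case by (intro exI[of _ 1]) (simp add: alpha_def)
next
  case (Suc s)
  then obtain C where C: "1 \<le> C" and IH: "\<And>N fs. 1 \<le> N \<Longrightarrow> set fs \<subseteq> cvx_pts s N \<Longrightarrow>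
      length fs = 2 ^ s \<Longrightarrow> (l2 (prod_list fs))\<^sup>2 \<le> C * real N powr (2 ^ (s + 1) - 1 - real s + alpha s)"
    by blast
  obtain c where c: "\<And>N f. f \<in> cvx_pts (Suc s) N \<Longrightarrow>
      \<exists>G. f = sum_list G \<and> length G \<le> c \<and> set G \<subseteq> mono_cvx_pts (Suc s) N"
    using cvx_pts_split[of "Suc s"] by blast
  define k where "k = (2::nat) ^ Suc s"
  \<comment> \<open>With this \<open>\<sigma>\<close> the induction hypothesis has the exponent
    \<open>k - \<sigma>\<close>.\<close>
  define \<sigma> where "\<sigma> = 1 + real s - alpha s"
  define D where "D = 3 ^ (k - 1) * (6 * C) ^ k"
  have k: "0 < k" "real k = 2 ^ Suc s" by (auto simp: k_def)
  have \<sigma>: "0 \<le> \<sigma>" "\<sigma> \<le> 1 + real s" using alpha_bounds[of s] by (auto simp: \<sigma>_def)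
  have \<sigma>k: "\<sigma> \<le> real k"
    using \<sigma>(2) of_nat_less_two_power[of "Suc s", where ?'a = real] k by simp
  have "1 * 1 \<le> D" using C unfolding D_def by (intro mult_mono one_le_power) auto
  then have D: "1 \<le> D" by simp
  have mono_bound: "(l2 (prod_list fs))\<^sup>2 \<le> D * real N powr (2 ^ (Suc s + 1) - 1 - real (Suc s) + alpha (Suc s))"
    if N: "1 \<le> N" and fs: "set fs \<subseteq> mono_cvx_pts (Suc s) N" "length fs = k" for N fs
  proof -
    \<comment> \<open>\<open>K\<close> is the bound per factor:
      \<open>K ^ k = C ^ k * N powr (k - \<sigma>)\<close> dominates the induction hypothesis for
      the squared norm of a product of \<open>k / 2\<close> factors.\<close>
    define K where "K = C * real N powr (1 - \<sigma> / k)"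
    define L where "L = nat \<lceil>real N powr (\<sigma> / k)\<rceil>"
    have K: "0 \<le> K" using C by (simp add: K_def)
    have L: "0 < L" using N by (simp add: L_def)
    have top: "l2 (prod_list gs) \<le> K ^ 2 ^ s" if gs: "set gs \<subseteq> cvx_pts s N" "length gs = 2 ^ s" for gs
    proof -
      have "(l2 (prod_list gs))\<^sup>2 \<le> C * real N powr (real k - \<sigma>)"
        using IH[OF N gs] k by (simp add: \<sigma>_def algebra_simps)
      also have "\<dots> \<le> C ^ k * real N powr (real k - \<sigma>)"
        using C k(1) self_le_power[of C k] by (intro mult_right_mono) auto
      also have "real k - \<sigma> = (1 - \<sigma> / k) * real k" using k(1) by (simp add: field_simps)
      also have "C ^ k * real N powr \<dots> = K ^ k"
        using N by (simp add: K_def power_mult_distrib powr_powr flip: powr_realpow)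
      also have "\<dots> = (K ^ 2 ^ s)\<^sup>2" by (simp add: k_def power_even_eq)
      finally show ?thesis by (rule power2_le_imp_le) (simp add: K)
    qed
    have "(l2 (prod_list fs))\<^sup>2 \<le> (2 * real (N div L) + 1) ^ (k - 1) *
        (real N + (2 * real L + 1) * K) ^ k"
      unfolding k_def by (rule energy_step[OF top K L fs(1) fs(2)[unfolded k_def]])
    also have "\<dots> \<le> D * real N powr (2 * real k - 1 - \<sigma> + \<sigma> / k)"
      unfolding D_def by (rule block_length_optimisation[OF N k(1) \<sigma>(1) \<sigma>k C K_def L_def])
    also have "\<dots> \<le> D * real N powr (2 ^ (Suc s + 1) - 1 - real (Suc s) + alpha (Suc s))"
    proof (intro mult_left_mono powr_mono)
      \<comment> \<open>The bound \<open>\<sigma> \<le> Suc s\<close> turns the loss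
        \<open>\<sigma> / k\<close> into the last summand of \<open>alpha (Suc s)\<close>.\<close>
      have "\<sigma> / k \<le> real (Suc s) / k" using \<sigma>(2) by (intro divide_right_mono) auto
      then show "2 * real k - 1 - \<sigma> + \<sigma> / k \<le> 2 ^ (Suc s + 1) - 1 - real (Suc s) + alpha (Suc s)"
        using k(2) by (simp add: alpha_Suc \<sigma>_def)
    qed (use N D in auto)
    finally show ?thesis .
  qed
  \<comment> \<open>Expanding \<open>k\<close> factors into at most \<open>c\<close> monotone pieces
    each gives at most \<open>c ^ k\<close> products, and this number is squared with the norm. The
    summand 1 ensures \<open>1 \<le> C'\<close> for every \<open>c\<close>.\<close>
  define C' where "C' = (real c ^ k)\<^sup>2 * D + 1"
  have "(l2 (prod_list fs))\<^sup>2 \<le> C' * real N powr (2 ^ (Suc s + 1) - 1 - real (Suc s) + alpha (Suc s))"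
    if N: "1 \<le> N" and fs: "set fs \<subseteq> cvx_pts (Suc s) N" "length fs = 2 ^ Suc s" for N fs
  proof -
    define Y where "Y = real N powr (2 ^ (Suc s + 1) - 1 - real (Suc s) + alpha (Suc s))"
    have "\<forall>f\<in>set fs. \<exists>G. f = sum_list G \<and> length G \<le> c \<and> set G \<subseteq> mono_cvx_pts (Suc s) N"
      using fs(1) c by blast
    then obtain G where G: "\<And>f. f \<in> set fs \<Longrightarrow> f = sum_list (G f)" "\<And>f. f \<in> set fs \<Longrightarrow> length (G f) \<le> c"
      "\<And>f. f \<in> set fs \<Longrightarrow> set (G f) \<subseteq> mono_cvx_pts (Suc s) N" by metis
    have "l2 (1 * prod_list (map sum_list (map G fs))) \<le>
        sqrt (D * Y) * (\<Prod>G\<leftarrow>map G fs. \<Sum>g\<leftarrow>G. 1)"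
    proof (rule l2_prod_sum_list_le)
      fix gs assume gs: "list_all2 (\<lambda>g G. g \<in> set G) gs (map G fs)"
      have "set gs \<subseteq> mono_cvx_pts (Suc s) N"
      proof
        fix g assume "g \<in> set gs"
        then obtain j where "j < length gs" "g = gs ! j" by (metis in_set_conv_nth)
        then have "j < length fs" "g \<in> set (G (fs ! j))"
          using list_all2_nthD[OF gs, of j] list_all2_lengthD[OF gs] by auto
        then show "g \<in> mono_cvx_pts (Suc s) N" using G(3) by (meson nth_mem subsetD)
      qed
      then have "(l2 (prod_list gs))\<^sup>2 \<le> D * Y"
        unfolding Y_def using mono_bound[OF N] list_all2_lengthD[OF gs] fs(2) by (simp add: k_def)
      moreover have "(\<Prod>g\<leftarrow>gs. 1) = (1::real)" by (induction gs) auto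
      ultimately show "l2 (1 * prod_list gs) \<le> sqrt (D * Y) * (\<Prod>g\<leftarrow>gs. 1)"
        by (simp add: real_le_rsqrt)
    qed
    also have "map sum_list (map G fs) = fs"
      using G(1) by (simp add: map_idI)
    finally have "l2 (prod_list fs) \<le> sqrt (D * Y) * (\<Prod>f\<leftarrow>fs. \<Sum>g\<leftarrow>G f. 1)"
      by (simp add: o_def)
    also have "(\<Prod>f\<leftarrow>fs. \<Sum>g\<leftarrow>G f. 1) \<le> real c ^ length fs"
      using G(2)
    proof (induction fs)
      case (Cons f fs)
      then show ?case
        by (auto simp: sum_list_triv intro!: mult_mono prod_list_nonneg)
    qed simp
    finally have "l2 (prod_list fs) \<le> sqrt (D * Y) * real c ^ k"
      using D by (simp add: Y_def fs(2) k_def mult_left_mono)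
    then have "(l2 (prod_list fs))\<^sup>2 \<le> (sqrt (D * Y) * real c ^ k)\<^sup>2"
      by (intro power_mono) auto
    also have "\<dots> = (real c ^ k)\<^sup>2 * D * Y"
      using D by (simp add: Y_def power_mult_distrib)
    also have "\<dots> \<le> C' * Y" by (simp add: C'_def Y_def algebra_simps)
    finally show ?thesis by (simp only: Y_def)
  qed
  moreover have "1 \<le> C'" using D by (simp add: C'_def)
  ultimately show ?case by blast
qed

section \<open>From the count \<open>T\<close> to norms\<close>

text \<open>The coefficients of the product are the numbers of representations as a sum, and the sum
  of their squares counts pairs of representations of the same number.\<close>

lemma T_eq_l2: "real (T k A) = (l2 (\<Prod>i<k. \<Sum>a\<in>A i. delta a))\<^sup>2" if "\<And>i. i < k \<Longrightarrow> finite (A i)"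
proof -
  let ?P = "PiE {..<k} A"
  have fin: "finite ?P" using that by (intro finite_PiE) auto
  have single_sum: "(\<Prod>i\<in>I. delta (p i)) = delta (\<Sum>i\<in>I. p i)" if "finite I" for p :: "nat \<Rightarrow> real" and I
    using that by (induction I) (simp_all add: mult_single)
  have "(\<Prod>i<k. \<Sum>a\<in>A i. delta a) = (\<Sum>p\<in>?P. delta (\<Sum>i<k. p i))"
    by (subst prod_sum_PiE) (use that single_sum in auto)
  then have "(l2 (\<Prod>i<k. \<Sum>a\<in>A i. delta a))\<^sup>2 =
      (\<Sum>p\<in>?P. \<Sum>q\<in>?P. if (\<Sum>i<k. p i) = (\<Sum>i<k. q i) then 1 else 0)"
    by (simp add: l2_square reflect_sum reflect_single sum_product mult_single lookup_sum lookup_single when_def)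
  also have "\<dots> = (\<Sum>(p, q)\<in>?P \<times> ?P. if (\<Sum>i<k. p i) = (\<Sum>i<k. q i) then 1 else 0)"
    by (rule sum.cartesian_product)
  also have "\<dots> = real (card {pq \<in> ?P \<times> ?P. (\<Sum>i<k. fst pq i) = (\<Sum>i<k. snd pq i)})"
    unfolding case_prod_unfold using fin by (subst sum.inter_filter[symmetric]) simp_all
  also have "{pq \<in> ?P \<times> ?P. (\<Sum>i<k. fst pq i) = (\<Sum>i<k. snd pq i)} =
      {(a, b). a \<in> ?P \<and> b \<in> ?P \<and> (\<Sum>i<k. a i) = (\<Sum>i<k. b i)}"
    by (simp only: mem_Times_iff case_prod_unfold conj_assoc)
  finally show ?thesis by (simp only: T_def)
qed

lemma convex_set_in_cvx_pts:
  assumes "convex_set s A" "card A \<le> N"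
  shows "(\<Sum>a\<in>A. delta a) \<in> cvx_pts s N"
proof -
  define xs where "xs = sorted_list_of_set A"
  have fin: "finite A" and xs: "convex_seq s xs" using assms by (auto simp: convex_set_def xs_def)
  have "(\<Sum>a\<in>A. delta a) = (\<Sum>a\<leftarrow>xs. delta a)"
    using fin by (simp add: xs_def sum_list_distinct_conv_sum_set)
  also have "\<dots> = pts ((!) xs) (length xs)"
    by (simp add: pts_def sum_list_sum_nth atLeast0LessThan)
  finally have "(\<Sum>a\<in>A. delta a) = pts ((!) xs) (length xs)" .
  moreover have "cvx s ((!) xs) (length xs)" using xs by (simp add: cvx_def map_nth)
  moreover have "length xs \<le> N" using assms(2) by (simp add: xs_def)
  ultimately show ?thesis unfolding cvx_pts_def by blast
qed

theorem theorem1p2: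
  fixes s :: nat
  shows "\<exists>C>0. \<forall>(N::nat) (A :: nat \<Rightarrow> real set).
           (\<forall>i<2^s. convex_set s (A i) \<and> card (A i) \<le> N) \<longrightarrow>
           real (T (2^s) A) \<le> C * real N powr (2 ^ (s+1) - 1 - real s + alpha s)"
proof -
  obtain C where C: "1 \<le> C" and bound: "\<And>N fs. 1 \<le> N \<Longrightarrow> set fs \<subseteq> cvx_pts s N \<Longrightarrow>
      length fs = 2 ^ s \<Longrightarrow> (l2 (prod_list fs))\<^sup>2 \<le> C * real N powr (2 ^ (s + 1) - 1 - real s + alpha s)"
    using l2_prod_cvx_pts_le[of s] by blast
  have "real (T (2^s) A) \<le> C * real N powr (2 ^ (s+1) - 1 - real s + alpha s)"
    if A: "\<And>i. i < 2 ^ s \<Longrightarrow> convex_set s (A i) \<and> card (A i) \<le> N" for N A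
  proof -
    have fin: "finite (A i)" if "i < 2 ^ s" for i using A[OF that] by (simp add: convex_set_def)
    show ?thesis
    proof (cases "N = 0")
      \<comment> \<open>The right side is 0 because \<open>0 powr y = 0\<close>, so the count itself
        has to vanish; index 0 is available as \<open>0 < 2 ^ s\<close>.\<close>
      case True
      then have "A 0 = {}" using A[of 0] fin[of 0] by simp
      then have "PiE {..<2 ^ s} A = {}" by (intro PiE_eq_empty_iff[THEN iffD2] bexI[of _ 0]) auto
      then show ?thesis by (simp add: T_def True)
    next
      case False
      define fs where "fs = map (\<lambda>i. \<Sum>a\<in>A i. delta a) [0..<2 ^ s]"
      have "set fs \<subseteq> cvx_pts s N"
        using convex_set_in_cvx_pts A by (auto simp: fs_def)
      moreover have "(\<Prod>i<2 ^ s. \<Sum>a\<in>A i. delta a) = prod_list fs"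
        by (simp add: fs_def prod.distinct_set_conv_list[symmetric] atLeast0LessThan)
      ultimately show ?thesis
        using bound[of N fs] False by (simp add: T_eq_l2 fin fs_def)
    qed
  qed
  then show ?thesis using C by (intro exI[of _ C]) auto
qed

end
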